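(* Let $M>0$ and assume that: (i) $\varphi$ is a continuous map from $[0,a]$ to $[0,a]$; (ii) $f$ is continuous on $\mathcal{D}_M$ and $|f(t,u,v)|\le M$ for all $(t,u,v)\in\mathcal{D}_M$; (iii) there are constants $L_1,L_2\ge 0$ such that $$|f(t,u_2,v_2)-f(t,u_1,v_1)|\le L_1|u_2-u_1|+L_2|v_2-v_1|\quad\text{for all }(t,u_i,v_i)\in\mathcal{D}_M\ (i=1,2);$$ (iv) $q:=(L_1+L_2)M_0<1$. Then the boundary value problem $$u'''(t)=f(t,u(t),u(\varphi(t))),\quad t\in[0,a],\qquad B_1[u]=b_1,\ B_2[u]=b_2,\ B_3[u]=b_3,$$ has a unique solution $u\in C^3[0,a]$ satisfying the estimate $$|u(t)|\le\|g\|+M_0M\quad\text{for all }t\in[0,a].$$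
   Context: Let $a>0$, $f:[0,a]\times\mathbb{R}\times\mathbb{R}\to\mathbb{R}$ a function and $\varphi:[0,a]\to[0,a]$. Let $\alpha_i,\beta_i,\gamma_i,b_i$ ($i=1,2,3$) be real numbers and define the boundary functionals $$B_1[u]=\alpha_1u(0)+\beta_1u'(0)+\gamma_1u''(0),\quad B_2[u]=\alpha_2u(0)+\beta_2u'(0)+\gamma_2u''(0),\quad B_3[u]=\alpha_3u(a)+\beta_3u'(a)+\gamma_3u''(a),$$ where the matrix $$\begin{pmatrix}\alpha_1&\beta_1&\gamma_1&0&0&0\\ \alpha_2&\beta_2&\gamma_2&0&0&0\\ 0&0&0&\alpha_3&\beta_3&\gamma_3\end{pmatrix}$$ has rank $3$. Assume that the homogeneous problem $u'''=0$, $B_1[u]=B_2[u]=B_3[u]=0$ has only the trivial solution. Let $G(t,s)$, $(t,s)\in[0,a]^2$, be the Green function of this problem, i.e. the continuous function such that for every $\psi\in C[0,a]$ the function $\int_0^aG(t,s)\psi(s)\,ds$ is the unique solution of $u'''=\psi$ on $[0,a]$ with $B_1[u]=B_2[u]=B_3[u]=0$. Let $g$ be the polynomial of degree at most $2$ with $B_i[g]=b_i$ ($i=1,2,3$). Then the solution of $u'''=\psi$, $B_i[u]=b_i$ ($i=1,2,3$), is $u(t)=g(t)+\int_0^aG(t,s)\psi(s)\,ds$. Put $\|g\|=\max_{0\le t\le a}|g(t)|$, $$M_0=\max_{0\le t\le a}\int_0^a|G(t,s)|\,ds,$$ $$\mathcal{D}_M=\{(t,u,v)\mid 0\le t\le a,\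 |u|\le\|g\|+M_0M,\ |v|\le\|g\|+M_0M\}.$$ *)

theory Defs
  imports "HOL-Analysis.Analysis" "HOL-Computational_Algebra.Polynomial"
begin

text \<open>Derivative of a function on \<open>[0,a]\<close>, one-sided at the end points. For \<open>a > 0\<close> and
  \<open>0 \<le> t \<le> a\<close> the value depends only on \<open>u\<close> restricted to \<open>[0,a]\<close>.\<close>

definition deriv_on :: "real \<Rightarrow> (real \<Rightarrow> real) \<Rightarrow> real \<Rightarrow> real" where
  "deriv_on a u t = vector_derivative u (at t within {0..a})"

definition C3_on :: "real \<Rightarrow> (real \<Rightarrow> real) \<Rightarrow> bool" where
  "C3_on a u \<longleftrightarrow>
     (\<forall>k<3. (deriv_on a ^^ k) u differentiable_on {0..a}) \<and>
     continuous_on {0..a} ((deriv_on a ^^ 3) u)"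

text \<open>The index type \<open>3\<close> has exactly the elements \<open>1\<close>, \<open>2\<close>, \<open>3\<close>. The functionals
  \<open>1\<close> and \<open>2\<close> act at \<open>0\<close>, the functional \<open>3\<close> acts at \<open>a\<close>.\<close>

definition bdry :: "real \<Rightarrow> real^3 \<Rightarrow> real^3 \<Rightarrow> real^3 \<Rightarrow> 3 \<Rightarrow> (real \<Rightarrow> real) \<Rightarrow> real" where
  "bdry a \<alpha> \<beta> \<gamma> i u =
     (let c = (if i = 3 then a else 0)
      in \<alpha> $ i * u c + \<beta> $ i * deriv_on a u c + \<gamma> $ i * (deriv_on a ^^ 2) u c)"

definition bdry_matrix :: "real^3 \<Rightarrow> real^3 \<Rightarrow> real^3 \<Rightarrow> real^6^3" where
  "bdry_matrix \<alpha> \<beta> \<gamma> =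
     vector [vector [\<alpha> $ 1, \<beta> $ 1, \<gamma> $ 1, 0, 0, 0],
             vector [\<alpha> $ 2, \<beta> $ 2, \<gamma> $ 2, 0, 0, 0],
             vector [0, 0, 0, \<alpha> $ 3, \<beta> $ 3, \<gamma> $ 3]]"

text \<open>\<open>u\<close> is a \<open>C\<^sup>3\<close> solution of \<open>u''' = \<psi>\<close> on \<open>[0,a]\<close> with \<open>B\<^sub>i[u] = b\<^sub>i\<close>. For the nonlinear
  problem \<open>\<psi>\<close> is instantiated with a right-hand side that itself involves \<open>u\<close>.\<close>

definition bvp_solution ::
  "real \<Rightarrow> real^3 \<Rightarrow> real^3 \<Rightarrow> real^3 \<Rightarrow> real^3 \<Rightarrow> (real \<Rightarrow> real) \<Rightarrow> (real \<Rightarrow> real) \<Rightarrow> bool" where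
  "bvp_solution a \<alpha> \<beta> \<gamma> b \<psi> u \<longleftrightarrow>
     C3_on a u \<and>
     (\<forall>t\<in>{0..a}. (deriv_on a ^^ 3) u t = \<psi> t) \<and>
     (\<forall>i. bdry a \<alpha> \<beta> \<gamma> i u = b $ i)"

definition green_function ::
  "real \<Rightarrow> real^3 \<Rightarrow> real^3 \<Rightarrow> real^3 \<Rightarrow> (real \<Rightarrow> real \<Rightarrow> real) \<Rightarrow> bool" where
  "green_function a \<alpha> \<beta> \<gamma> G \<longleftrightarrow>
     continuous_on ({0..a} \<times> {0..a}) (\<lambda>(t, s). G t s) \<and>
     (\<forall>\<psi>. continuous_on {0..a} \<psi> \<longrightarrow>
        bvp_solution a \<alpha> \<beta> \<gamma> 0 \<psi> (\<lambda>t. integral {0..a} (\<lambda>s. G t s * \<psi> s)) \<and>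
        (\<forall>u. bvp_solution a \<alpha> \<beta> \<gamma> 0 \<psi> u \<longrightarrow>
           (\<forall>t\<in>{0..a}. u t = integral {0..a} (\<lambda>s. G t s * \<psi> s))))"

text \<open>In \<open>max_norm\<close> and \<open>green_bound\<close> the supremum is a maximum, since for \<open>a > 0\<close> it is taken over
  a nonempty compact interval and the functions it is applied to are continuous there.\<close>

definition max_norm :: "real \<Rightarrow> (real \<Rightarrow> real) \<Rightarrow> real" where
  "max_norm a h = (SUP t\<in>{0..a}. \<bar>h t\<bar>)"

definition green_bound :: "real \<Rightarrow> (real \<Rightarrow> real \<Rightarrow> real) \<Rightarrow> real" where
  "green_bound a G = (SUP t\<in>{0..a}. integral {0..a} (\<lambda>s. \<bar>G t s\<bar>))"

definition region ::
  "real \<Rightarrow> (real \<Rightarrow> real) \<Rightarrow> (real \<Rightarrow> real \<Rightarrow> real) \<Rightarrow> real \<Rightarrow> (real \<times> real \<times> real) set" where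
  "region a g G M =
     {(t, u, v). 0 \<le> t \<and> t \<le> a \<and>
        \<bar>u\<bar> \<le> max_norm a g + green_bound a G * M \<and>
        \<bar>v\<bar> \<le> max_norm a g + green_bound a G * M}"

end

theory Submission imports Defs begin

text \<open>
  Write \<open>F u\<close> for the function \<open>s \<mapsto> f s (u s) (u (\<phi> s))\<close> and
  \<open>T u = g + \<integral> G(\<cdot>,s) (F u)(s) ds\<close>. Whenever \<open>F u\<close> is continuous, \<open>T u\<close> is the only solution of
  \<open>w''' = F u\<close>, \<open>B\<^sub>i[w] = b\<^sub>i\<close>: the Green function solves the problem with zero boundary data, the
  quadratic \<open>g\<close> has the right boundary data and zero third derivative, and the problem is linear
  (\<open>bvp_solution_linear\<close>, \<open>green_function_solves\<close>, \<open>green_function_unique\<close>). Hence the solutions of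
  the nonlinear problem with \<open>|u| \<le> R = \<parallel>g\<parallel> + M\<^sub>0 M\<close> are exactly the fixed points of \<open>T\<close> in the ball
  of radius \<open>R\<close> in \<open>C[0,a]\<close>.

  Everything then follows from the single estimate
  \<open>|\<integral> G(t,s) \<psi>(s) ds| \<le> M\<^sub>0 sup |\<psi>|\<close> (\<open>integral_kernel_le\<close>). With \<open>\<psi> = F u\<close>, where the bound on
  \<open>f\<close> gives \<open>|\<psi>| \<le> M\<close>, it shows that \<open>T\<close> maps the ball into itself. With \<open>\<psi> = F u - F v\<close>,
  where the Lipschitz condition gives \<open>|\<psi>| \<le> (L\<^sub>1 + L\<^sub>2) sup |u - v|\<close>, it shows that \<open>T\<close> contracts
  with factor \<open>q = (L\<^sub>1 + L\<^sub>2) M\<^sub>0 < 1\<close>. Since \<open>\<phi>\<close> maps \<open>[0,a]\<close> into itself, \<open>u \<circ> \<phi>\<close> obeys the same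
  bounds as \<open>u\<close>. Banach's fixed point theorem
  (\<open>contraction_fixpoint_exists\<close>, \<open>contraction_fixpoint_unique\<close>) finishes the argument.
\<close>

section \<open>Three times differentiable functions on a compact interval\<close>

text \<open>The iterated one-sided derivatives in \<open>C3_on\<close> and \<open>bdry\<close> are awkward to differentiate
  algebraically. Naming the three derivatives as explicit functions, constrained only on \<open>[0,a]\<close>,
  lets the usual rules for \<open>has_vector_derivative\<close> apply term by term.\<close>

definition derivs3_on ::
  "real \<Rightarrow> (real \<Rightarrow> real) \<Rightarrow> (real \<Rightarrow> real) \<Rightarrow> (real \<Rightarrow> real) \<Rightarrow> (real \<Rightarrow> real) \<Rightarrow> bool" where
  "derivs3_on a u u1 u2 u3 \<longleftrightarrow>
     (\<forall>t\<in>{0..a}. (u has_vector_derivative u1 t) (at t within {0..a}) \<and>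
        (u1 has_vector_derivative u2 t) (at t within {0..a}) \<and>
        (u2 has_vector_derivative u3 t) (at t within {0..a}))"

lemma deriv_on_eqI:
  assumes "a > 0" "t \<in> {0..a}" "(v has_vector_derivative d) (at t within {0..a})"
    and "\<And>s. s \<in> {0..a} \<Longrightarrow> u s = v s"
  shows "(u has_vector_derivative d) (at t within {0..a})" "deriv_on a u t = d"
proof -
  show *: "(u has_vector_derivative d) (at t within {0..a})"
    using has_vector_derivative_transform[OF assms(2) assms(4) assms(3)] .
  show "deriv_on a u t = d"
    unfolding deriv_on_def
    using assms * by (intro vector_derivative_within_closed_interval) auto
qed

text \<open>The named derivatives agree with the iterates of \<open>deriv_on\<close> on \<open>[0,a]\<close> only, so each further
  differentiation has to transfer a derivative between functions that may differ outside the
  interval; this is what \<open>deriv_on_eqI\<close> provides.\<close>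

lemma derivs3_on_deriv_on:
  assumes "a > 0" "derivs3_on a u u1 u2 u3" "t \<in> {0..a}"
  shows "deriv_on a u t = u1 t" "(deriv_on a ^^ 2) u t = u2 t" "(deriv_on a ^^ 3) u t = u3 t"
    and "((deriv_on a ^^ 2) u has_vector_derivative u3 t) (at t within {0..a})"
    and "(deriv_on a u has_vector_derivative u2 t) (at t within {0..a})"
proof -
  have 1: "deriv_on a u s = u1 s" if "s \<in> {0..a}" for s
    using deriv_on_eqI(2)[OF assms(1) that, of u] assms(2) that unfolding derivs3_on_def by blast
  have 2: "(deriv_on a u has_vector_derivative u2 s) (at s within {0..a})"
    "(deriv_on a ^^ 2) u s = u2 s" if "s \<in> {0..a}" for s
    using deriv_on_eqI[OF assms(1) that, of u1 "u2 s" "deriv_on a u"] 1 assms(2) that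
    unfolding derivs3_on_def by (auto simp: numeral_2_eq_2)
  have 3: "((deriv_on a ^^ 2) u has_vector_derivative u3 s) (at s within {0..a})"
    "(deriv_on a ^^ 3) u s = u3 s" if "s \<in> {0..a}" for s
    using deriv_on_eqI[OF assms(1) that, of u2 "u3 s" "(deriv_on a ^^ 2) u"] 2 assms(2) that
    unfolding derivs3_on_def by (auto simp: numeral_2_eq_2 numeral_3_eq_3)
  show "deriv_on a u t = u1 t" "(deriv_on a ^^ 2) u t = u2 t" "(deriv_on a ^^ 3) u t = u3 t"
    "((deriv_on a ^^ 2) u has_vector_derivative u3 t) (at t within {0..a})"
    "(deriv_on a u has_vector_derivative u2 t) (at t within {0..a})"
    using 1 2 3 assms(3) by auto
qed

lemma C3_on_iff_derivs3_on:
  assumes "a > 0"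
  shows "C3_on a u \<longleftrightarrow> (\<exists>u1 u2 u3. derivs3_on a u u1 u2 u3 \<and> continuous_on {0..a} u3)"
proof
  assume u: "C3_on a u"
  have d: "(v has_vector_derivative deriv_on a v t) (at t within {0..a})"
    if "v differentiable_on {0..a}" "t \<in> {0..a}" for v t
    using that vector_derivative_works unfolding deriv_on_def differentiable_on_def by blast
  have "(deriv_on a ^^ k) u differentiable_on {0..a}" if "k < 3" for k
    using u that unfolding C3_on_def by blast
  from this[of 0] this[of 1] this[of 2]
  have "derivs3_on a u (deriv_on a u) ((deriv_on a ^^ 2) u) ((deriv_on a ^^ 3) u)"
    unfolding derivs3_on_def using d by (simp add: numeral_2_eq_2 numeral_3_eq_3)
  then show "\<exists>u1 u2 u3. derivs3_on a u u1 u2 u3 \<and> continuous_on {0..a} u3"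
    using u unfolding C3_on_def by blast
next
  assume "\<exists>u1 u2 u3. derivs3_on a u u1 u2 u3 \<and> continuous_on {0..a} u3"
  then obtain u1 u2 u3 where u: "derivs3_on a u u1 u2 u3" and c: "continuous_on {0..a} u3"
    by blast
  note D = derivs3_on_deriv_on[OF assms u]
  have "(deriv_on a ^^ k) u differentiable (at t within {0..a})" if "k < 3" "t \<in> {0..a}" for k t
  proof -
    consider "k = 0" | "k = 1" | "k = 2" using \<open>k < 3\<close> by linarith
    then show ?thesis
    proof cases
      case 1 then show ?thesis
        using u \<open>t \<in> _\<close> unfolding derivs3_on_def
        by (auto intro: differentiableI_vector)
    qed (use D(4,5)[OF \<open>t \<in> _\<close>] in \<open>auto intro: differentiableI_vector\<close>)
  qed
  then show "C3_on a u"
    unfolding C3_on_def differentiable_on_def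
    using continuous_on_cong[of "{0..a}" "{0..a}" "(deriv_on a ^^ 3) u" u3] c D(3) by simp
qed

lemma bvp_solution_continuous_on:
  assumes "bvp_solution a \<alpha> \<beta> \<gamma> b \<psi> u"
  shows "continuous_on {0..a} u"
proof -
  have "(deriv_on a ^^ 0) u differentiable_on {0..a}"
    using assms unfolding bvp_solution_def C3_on_def by (metis zero_less_numeral)
  then show ?thesis by (simp add: differentiable_imp_continuous_on)
qed

lemma bvp_solution_cong:
  assumes "\<And>t. t \<in> {0..a} \<Longrightarrow> \<psi> t = \<psi>' t"
  shows "bvp_solution a \<alpha> \<beta> \<gamma> b \<psi> u \<longleftrightarrow> bvp_solution a \<alpha> \<beta> \<gamma> b \<psi>' u"
  using assms unfolding bvp_solution_def by auto

lemma bvp_solution_linear: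
  assumes a: "a > 0"
    and u: "bvp_solution a \<alpha> \<beta> \<gamma> b \<psi> u" and v: "bvp_solution a \<alpha> \<beta> \<gamma> b' \<psi>' v"
  shows "bvp_solution a \<alpha> \<beta> \<gamma> (b + c *\<^sub>R b') (\<lambda>t. \<psi> t + c * \<psi>' t) (\<lambda>t. u t + c * v t)"
proof -
  obtain u1 u2 u3 where U: "derivs3_on a u u1 u2 u3" and U3: "continuous_on {0..a} u3"
    using u C3_on_iff_derivs3_on[OF a] unfolding bvp_solution_def by blast
  obtain v1 v2 v3 where V: "derivs3_on a v v1 v2 v3" and V3: "continuous_on {0..a} v3"
    using v C3_on_iff_derivs3_on[OF a] unfolding bvp_solution_def by blast
  have W: "derivs3_on a (\<lambda>t. u t + c * v t) (\<lambda>t. u1 t + c * v1 t) (\<lambda>t. u2 t + c * v2 t)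
     (\<lambda>t. u3 t + c * v3 t)" (is "derivs3_on a ?w ?w1 ?w2 ?w3")
    using U V unfolding derivs3_on_def
    by (auto intro!: has_vector_derivative_add has_vector_derivative_mult_right)
  note D = derivs3_on_deriv_on(1-3)[OF a U] derivs3_on_deriv_on(1-3)[OF a V]
    derivs3_on_deriv_on(1-3)[OF a W]
  have "continuous_on {0..a} ?w3" by (intro continuous_intros U3 V3)
  then have "C3_on a ?w" using W C3_on_iff_derivs3_on[OF a] by blast
  moreover have "(deriv_on a ^^ 3) ?w t = \<psi> t + c * \<psi>' t" if "t \<in> {0..a}" for t
    using u v D[OF that] that unfolding bvp_solution_def by simp
  moreover have "bdry a \<alpha> \<beta> \<gamma> i ?w = (b + c *\<^sub>R b') $ i" for i
  proof -
    define p where "p = (if i = 3 then a else 0)"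
    have p: "p \<in> {0..a}" using a by (simp add: p_def)
    have "bdry a \<alpha> \<beta> \<gamma> i ?w = bdry a \<alpha> \<beta> \<gamma> i u + c * bdry a \<alpha> \<beta> \<gamma> i v"
      unfolding bdry_def Let_def p_def[symmetric] D[OF p] by (simp add: algebra_simps)
    then show ?thesis using u v unfolding bvp_solution_def by simp
  qed
  ultimately show ?thesis unfolding bvp_solution_def by blast
qed

lemma bvp_solution_quadratic:
  fixes g :: "real poly"
  assumes a: "a > 0" and "degree g \<le> 2" and b: "\<And>i. bdry a \<alpha> \<beta> \<gamma> i (poly g) = b $ i"
  shows "bvp_solution a \<alpha> \<beta> \<gamma> b (\<lambda>t. 0) (poly g)"
proof -
  have "degree (pderiv (pderiv g)) = 0" using assms(2) by (simp add: degree_pderiv)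
  then have 0: "pderiv (pderiv (pderiv g)) = 0" by (simp add: pderiv_eq_0_iff)
  have "(poly p has_vector_derivative poly (pderiv p) t) (at t within {0..a})"
    for p :: "real poly" and t
    unfolding has_real_derivative_iff_has_vector_derivative[symmetric]
    by (rule has_field_derivative_at_within[OF poly_DERIV])
  then have D: "derivs3_on a (poly g) (poly (pderiv g)) (poly (pderiv (pderiv g))) (\<lambda>t. 0)"
    unfolding derivs3_on_def using 0 by (metis poly_0)
  then have "C3_on a (poly g)"
    using C3_on_iff_derivs3_on[OF a] continuous_on_const by blast
  then show ?thesis
    unfolding bvp_solution_def using b derivs3_on_deriv_on(3)[OF a D] by simp
qed

section \<open>The Green function and its norm\<close>

lemma green_function_solves:
  fixes g :: "real poly"
  assumes a: "a > 0" and G: "green_function a \<alpha> \<beta> \<gamma> G"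
    and g: "degree g \<le> 2" "\<And>i. bdry a \<alpha> \<beta> \<gamma> i (poly g) = b $ i"
    and \<psi>: "continuous_on {0..a} \<psi>"
  shows "bvp_solution a \<alpha> \<beta> \<gamma> b \<psi> (\<lambda>t. poly g t + integral {0..a} (\<lambda>s. G t s * \<psi> s))"
proof -
  have "bvp_solution a \<alpha> \<beta> \<gamma> 0 \<psi> (\<lambda>t. integral {0..a} (\<lambda>s. G t s * \<psi> s))"
    using G \<psi> unfolding green_function_def by blast
  from bvp_solution_linear[OF a bvp_solution_quadratic[OF a g] this, of 1]
  show ?thesis by simp
qed

lemma green_function_unique:
  fixes g :: "real poly"
  assumes a: "a > 0" and G: "green_function a \<alpha> \<beta> \<gamma> G"
    and g: "degree g \<le> 2" "\<And>i. bdry a \<alpha> \<beta> \<gamma> i (poly g) = b $ i"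
    and \<psi>: "continuous_on {0..a} \<psi>"
    and w: "bvp_solution a \<alpha> \<beta> \<gamma> b \<psi> w" and t: "t \<in> {0..a}"
  shows "w t = poly g t + integral {0..a} (\<lambda>s. G t s * \<psi> s)"
proof -
  have "bvp_solution a \<alpha> \<beta> \<gamma> 0 \<psi> (\<lambda>t. w t - poly g t)"
    using bvp_solution_linear[OF a w bvp_solution_quadratic[OF a g], of "-1"] by simp
  then have "w t - poly g t = integral {0..a} (\<lambda>s. G t s * \<psi> s)"
    using G \<psi> t unfolding green_function_def by blast
  then show ?thesis by simp
qed

lemma continuous_on_slice:
  fixes G :: "real \<Rightarrow> real \<Rightarrow> real"
  assumes "continuous_on ({0..a} \<times> {0..a}) (\<lambda>(t, s). G t s)" "t \<in> {0..a}"
  shows "continuous_on {0..a} (G t)"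
proof -
  have "continuous_on {0..a} ((\<lambda>(t, s). G t s) \<circ> Pair t)"
    using assms
    by (intro continuous_on_compose continuous_intros)
       (auto intro: continuous_on_subset[OF assms(1)])
  then show ?thesis by (simp add: o_def)
qed

text \<open>A supremum of reals bounds its members only if it is taken over a set that is bounded above.
  Here that holds because \<open>G\<close> is bounded on the compact square.\<close>

lemma green_bound_upper:
  fixes G :: "real \<Rightarrow> real \<Rightarrow> real"
  assumes G: "continuous_on ({0..a} \<times> {0..a}) (\<lambda>(t, s). G t s)" and t: "t \<in> {0..a}"
  shows "integral {0..a} (\<lambda>s. \<bar>G t s\<bar>) \<le> green_bound a G"
proof -
  have "bounded ((\<lambda>(t, s). G t s) ` ({0..a} \<times> {0..a}))"
    by (intro compact_imp_bounded compact_continuous_image G compact_Times) auto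
  then obtain C where C: "\<And>t s. t \<in> {0..a} \<Longrightarrow> s \<in> {0..a} \<Longrightarrow> \<bar>G t s\<bar> \<le> C"
    unfolding bounded_iff by fastforce
  have "integral {0..a} (\<lambda>s. \<bar>G r s\<bar>) \<le> integral {0..a} (\<lambda>s. C)" if "r \<in> {0..a}" for r
    by (intro integral_le integrable_continuous_interval continuous_on_rabs
          continuous_on_slice[OF G that]) (use C that in auto)
  then have "bdd_above ((\<lambda>t. integral {0..a} (\<lambda>s. \<bar>G t s\<bar>)) ` {0..a})"
    by (rule bdd_aboveI2)
  then show ?thesis unfolding green_bound_def using t by (rule cSUP_upper2) simp
qed

text \<open>The operator with kernel \<open>G\<close> has norm at most \<open>green_bound a G\<close> on \<open>C[0,a]\<close> with the maximum
  norm.\<close>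

lemma integral_kernel_le:
  fixes G :: "real \<Rightarrow> real \<Rightarrow> real"
  assumes G: "continuous_on ({0..a} \<times> {0..a}) (\<lambda>(t, s). G t s)" and t: "t \<in> {0..a}"
    and \<psi>: "continuous_on {0..a} \<psi>" and K: "\<And>s. s \<in> {0..a} \<Longrightarrow> \<bar>\<psi> s\<bar> \<le> K"
  shows "\<bar>integral {0..a} (\<lambda>s. G t s * \<psi> s)\<bar> \<le> green_bound a G * K"
proof -
  note c = continuous_on_slice[OF G t]
  have "0 \<le> K" using K[OF t] by linarith
  have "norm (integral {0..a} (\<lambda>s. G t s * \<psi> s)) \<le> integral {0..a} (\<lambda>s. \<bar>G t s\<bar> * K)"
    by (intro integral_norm_bound_integral integrable_continuous_interval continuous_intros c \<psi>)
       (auto simp: abs_mult intro!: mult_left_mono K)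
  also have "\<dots> = integral {0..a} (\<lambda>s. \<bar>G t s\<bar>) * K" by simp
  also have "\<dots> \<le> green_bound a G * K"
    by (intro mult_right_mono green_bound_upper G t \<open>0 \<le> K\<close>)
  finally show ?thesis by simp
qed

lemma abs_le_max_norm:
  assumes "continuous_on {0..a} h" "t \<in> {0..a}"
  shows "\<bar>h t\<bar> \<le> max_norm a h"
proof -
  have "bdd_above ((\<lambda>t. \<bar>h t\<bar>) ` {0..a})"
    by (intro bounded_imp_bdd_above compact_imp_bounded compact_continuous_image
          continuous_on_rabs assms) auto
  then show ?thesis unfolding max_norm_def using assms(2) by (rule cSUP_upper2) simp
qed

section \<open>Contractions of a ball of continuous functions\<close>

text \<open>Functions on \<open>[0,a]\<close> are represented by bounded continuous functions on the whole line, which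
  form a complete space. Precomposing \<open>T u\<close> with the retraction \<open>p\<close> of the line onto \<open>[0,a]\<close> turns
  \<open>T\<close> into a map \<open>F\<close> of the closed ball of that space: a value of \<open>F x\<close> anywhere is a value of
  \<open>T x\<close> on \<open>[0,a]\<close>, so bounds on \<open>[0,a]\<close> become bounds on the line. The contraction property is
  phrased with an arbitrary pointwise bound \<open>c\<close> in place of a norm.\<close>

lemma contraction_fixpoint_exists:
  fixes T :: "(real \<Rightarrow> real) \<Rightarrow> real \<Rightarrow> real"
  assumes "0 \<le> a" "0 \<le> R" "0 \<le> q" "q < 1"
    and cont: "\<And>u. continuous_on {0..a} u \<Longrightarrow> (\<And>t. t \<in> {0..a} \<Longrightarrow> \<bar>u t\<bar> \<le> R) \<Longrightarrow>
        continuous_on {0..a} (T u)"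
    and ball: "\<And>u t. continuous_on {0..a} u \<Longrightarrow> (\<And>t. t \<in> {0..a} \<Longrightarrow> \<bar>u t\<bar> \<le> R) \<Longrightarrow>
        t \<in> {0..a} \<Longrightarrow> \<bar>T u t\<bar> \<le> R"
    and contr: "\<And>u v c t. continuous_on {0..a} u \<Longrightarrow> (\<And>t. t \<in> {0..a} \<Longrightarrow> \<bar>u t\<bar> \<le> R) \<Longrightarrow>
        continuous_on {0..a} v \<Longrightarrow> (\<And>t. t \<in> {0..a} \<Longrightarrow> \<bar>v t\<bar> \<le> R) \<Longrightarrow>
        (\<And>t. t \<in> {0..a} \<Longrightarrow> \<bar>u t - v t\<bar> \<le> c) \<Longrightarrow> t \<in> {0..a} \<Longrightarrow>
        \<bar>T u t - T v t\<bar> \<le> q * c"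
  obtains u where "continuous_on {0..a} u" "\<And>t. t \<in> {0..a} \<Longrightarrow> \<bar>u t\<bar> \<le> R"
    "\<And>t. t \<in> {0..a} \<Longrightarrow> u t = T u t"
proof -
  define p where "p t = max 0 (min a t)" for t :: real
  have p: "p t \<in> {0..a}" for t using \<open>0 \<le> a\<close> by (auto simp: p_def)
  have p_id: "p t = t" if "t \<in> {0..a}" for t using that by (auto simp: p_def)
  define F where "F x = Bcontfun (\<lambda>t. T (apply_bcontfun x) (p t))" for x
  define S where "S = cball (0 :: real \<Rightarrow>\<^sub>C real) R"
  have S: "continuous_on {0..a} (apply_bcontfun x)" "\<bar>apply_bcontfun x t\<bar> \<le> R" if "x \<in> S" for x t
  proof -
    show "continuous_on {0..a} (apply_bcontfun x)"
      by (intro continuous_on_subset[OF continuous_on_apply_bcontfun]) auto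
    show "\<bar>apply_bcontfun x t\<bar> \<le> R"
      using norm_bounded[of x t] that unfolding S_def by simp
  qed
  have F: "apply_bcontfun (F x) t = T (apply_bcontfun x) (p t)" if "x \<in> S" for x t
  proof -
    have "continuous_on UNIV (\<lambda>t. T (apply_bcontfun x) (p t))"
      using p unfolding p_def
      by (intro continuous_on_compose2[OF cont[OF S[OF that]]] continuous_intros) auto
    moreover have "norm (T (apply_bcontfun x) (p t)) \<le> R" for t
      using ball[OF S[OF that] p] by simp
    ultimately have "(\<lambda>t. T (apply_bcontfun x) (p t)) \<in> bcontfun"
      by (intro bcontfun_normI)
    then show ?thesis unfolding F_def by (simp add: Bcontfun_inverse)
  qed
  have "\<exists>!x\<in>S. F x = x"
  proof (rule Banach_fix[where c = q])
    show "complete S" unfolding S_def by (simp add: complete_eq_closed)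
    show "S \<noteq> {}" using \<open>0 \<le> R\<close> by (auto simp: S_def)
    show "F ` S \<subseteq> S"
    proof safe
      fix x assume x: "x \<in> S"
      have "norm (F x) \<le> R"
        using F[OF x] ball[OF S[OF x] p] by (intro norm_bound) auto
      then show "F x \<in> S" by (simp add: S_def)
    qed
    show "dist (F x) (F y) \<le> q * dist x y" if x: "x \<in> S" and y: "y \<in> S" for x y
    proof -
      have "\<bar>apply_bcontfun x t - apply_bcontfun y t\<bar> \<le> dist x y" for t
        using dist_bounded[of x t y] by (simp add: dist_real_def)
      then show ?thesis
        using F x y contr[OF S[OF x] S[OF y] _ p]
        by (intro dist_bound) (auto simp: dist_real_def)
    qed
  qed (use assms in auto)
  then obtain x where x: "x \<in> S" "F x = x" by blast
  show thesis
  proof (rule that[of "apply_bcontfun x"])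
    show "apply_bcontfun x t = T (apply_bcontfun x) t" if "t \<in> {0..a}" for t
      using F[OF x(1), of t] x(2) p_id[OF that] by simp
  qed (use S[OF x(1)] in auto)
qed

text \<open>The maximum of \<open>|u - v|\<close> is attained at some \<open>r\<close>; using it as the bound \<open>c\<close> gives
  \<open>|u r - v r| \<le> q |u r - v r|\<close>. Arguing on \<open>[0,a]\<close> directly avoids extending the given functions
  to the line.\<close>

lemma contraction_fixpoint_unique:
  fixes u v :: "real \<Rightarrow> real"
  assumes "0 \<le> a" "q < 1" "continuous_on {0..a} u" "continuous_on {0..a} v"
    and contr: "\<And>c t. (\<And>t. t \<in> {0..a} \<Longrightarrow> \<bar>u t - v t\<bar> \<le> c) \<Longrightarrow> t \<in> {0..a} \<Longrightarrow> \<bar>u t - v t\<bar> \<le> q * c"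
    and t: "t \<in> {0..a}"
  shows "u t = v t"
proof -
  have "continuous_on {0..a} (\<lambda>t. \<bar>u t - v t\<bar>)" by (intro continuous_intros assms)
  then obtain r where r: "r \<in> {0..a}" "\<And>t. t \<in> {0..a} \<Longrightarrow> \<bar>u t - v t\<bar> \<le> \<bar>u r - v r\<bar>"
    using continuous_attains_sup[of "{0..a}"] \<open>0 \<le> a\<close> by fastforce
  have "(1 - q) * \<bar>u r - v r\<bar> \<le> 0"
    using contr[OF r(2) r(1)] by (simp add: algebra_simps)
  then have "\<bar>u r - v r\<bar> \<le> 0" using \<open>q < 1\<close> by (simp add: mult_le_0_iff)
  then show ?thesis using r(2)[OF t] by linarith
qed

section \<open>Existence and uniqueness\<close>

theorem theorem2p2:
  fixes a M L1 L2 :: real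
    and \<alpha> \<beta> \<gamma> b :: "real^3"
    and f :: "real \<Rightarrow> real \<Rightarrow> real \<Rightarrow> real"
    and \<phi> :: "real \<Rightarrow> real"
    and G :: "real \<Rightarrow> real \<Rightarrow> real"
    and g :: "real poly"
  assumes "a > 0"
    and "rank (bdry_matrix \<alpha> \<beta> \<gamma>) = 3"
    and "\<And>u. bvp_solution a \<alpha> \<beta> \<gamma> 0 (\<lambda>t. 0) u \<Longrightarrow> \<forall>t\<in>{0..a}. u t = 0"
    and "green_function a \<alpha> \<beta> \<gamma> G"
    and "degree g \<le> 2"
    and "\<And>i. bdry a \<alpha> \<beta> \<gamma> i (poly g) = b $ i"
    and "M > 0"
    and "continuous_on {0..a} \<phi>"
    and "\<phi> \<in> {0..a} \<rightarrow> {0..a}"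
    and "continuous_on (region a (poly g) G M) (\<lambda>(t, u, v). f t u v)"
    and "\<And>t u v. (t, u, v) \<in> region a (poly g) G M \<Longrightarrow> \<bar>f t u v\<bar> \<le> M"
    and "L1 \<ge> 0" and "L2 \<ge> 0"
    and "\<And>t u1 v1 u2 v2. (t, u1, v1) \<in> region a (poly g) G M \<Longrightarrow>
           (t, u2, v2) \<in> region a (poly g) G M \<Longrightarrow>
           \<bar>f t u2 v2 - f t u1 v1\<bar> \<le> L1 * \<bar>u2 - u1\<bar> + L2 * \<bar>v2 - v1\<bar>"
    and "(L1 + L2) * green_bound a G < 1"
  shows "\<exists>u. (bvp_solution a \<alpha> \<beta> \<gamma> b (\<lambda>t. f t (u t) (u (\<phi> t))) u \<and>
              (\<forall>t\<in>{0..a}. \<bar>u t\<bar> \<le> max_norm a (poly g) + green_bound a G * M)) \<and>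
             (\<forall>w. bvp_solution a \<alpha> \<beta> \<gamma> b (\<lambda>t. f t (w t) (w (\<phi> t))) w \<and>
                  (\<forall>t\<in>{0..a}. \<bar>w t\<bar> \<le> max_norm a (poly g) + green_bound a G * M) \<longrightarrow>
                  (\<forall>t\<in>{0..a}. w t = u t))"
proof -
  note a = assms(1) and G = assms(4) and g = assms(5,6)
  have a0: "0 \<le> a" "0 \<in> {0..a}" using a by auto
  have Gc: "continuous_on ({0..a} \<times> {0..a}) (\<lambda>(t, s). G t s)"
    using G unfolding green_function_def by blast
  define R where "R = max_norm a (poly g) + green_bound a G * M"
  define q where "q = (L1 + L2) * green_bound a G"
  define F where "F u = (\<lambda>s. f s (u s) (u (\<phi> s)))" for u :: "real \<Rightarrow> real"
  define T where "T u = (\<lambda>t. poly g t + integral {0..a} (\<lambda>s. G t s * F u s))" for u :: "real \<Rightarrow> real"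
  have gb: "0 \<le> green_bound a G"
    using green_bound_upper[OF Gc a0(2)]
      integral_nonneg[OF integrable_continuous_interval[OF
        continuous_on_rabs[OF continuous_on_slice[OF Gc a0(2)]]]]
    by fastforce
  have gn: "\<bar>poly g t\<bar> \<le> max_norm a (poly g)" if "t \<in> {0..a}" for t
    by (intro abs_le_max_norm that continuous_intros)
  have R: "0 \<le> R" using gn[OF a0(2)] gb \<open>M > 0\<close> by (auto simp: R_def)
  have q: "0 \<le> q" "q < 1" using assms(12,13,15) gb by (auto simp: q_def)
  have \<phi>: "\<phi> s \<in> {0..a}" if "s \<in> {0..a}" for s using assms(9) that by blast
  have region: "(s, u s, u (\<phi> s)) \<in> region a (poly g) G M"
    if "\<And>t. t \<in> {0..a} \<Longrightarrow> \<bar>u t\<bar> \<le> R" "s \<in> {0..a}" for u s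
    using that(1)[OF that(2)] that(1)[OF \<phi>[OF that(2)]] that(2)
    unfolding region_def R_def by simp
  have Fc: "continuous_on {0..a} (F u)"
    if u: "continuous_on {0..a} u" "\<And>t. t \<in> {0..a} \<Longrightarrow> \<bar>u t\<bar> \<le> R" for u
  proof -
    have "continuous_on {0..a} (\<lambda>s. u (\<phi> s))"
      by (rule continuous_on_compose2[OF u(1) assms(8)]) (use \<phi> in auto)
    then have "continuous_on {0..a} (\<lambda>s. (s, u s, u (\<phi> s)))"
      by (intro continuous_intros u(1))
    moreover have "(\<lambda>s. (s, u s, u (\<phi> s))) ` {0..a} \<subseteq> region a (poly g) G M"
      using region[of u] u(2) by blast
    ultimately have "continuous_on {0..a} (\<lambda>s. case (s, u s, u (\<phi> s)) of (t, u, v) \<Rightarrow> f t u v)"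
      by (rule continuous_on_compose2[OF assms(10)])
    then show ?thesis unfolding F_def by simp
  qed
  have Fb: "\<bar>F u s\<bar> \<le> M" if "\<And>t. t \<in> {0..a} \<Longrightarrow> \<bar>u t\<bar> \<le> R" "s \<in> {0..a}" for u s
    unfolding F_def using assms(11)[OF region[OF that]] .
  have Tsol: "bvp_solution a \<alpha> \<beta> \<gamma> b (F u) (T u)"
    if "continuous_on {0..a} u" "\<And>t. t \<in> {0..a} \<Longrightarrow> \<bar>u t\<bar> \<le> R" for u
    unfolding T_def by (rule green_function_solves[OF a G g Fc[OF that]])
  have Tb: "\<bar>T u t\<bar> \<le> R"
    if "continuous_on {0..a} u" "\<And>t. t \<in> {0..a} \<Longrightarrow> \<bar>u t\<bar> \<le> R" "t \<in> {0..a}" for u t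
    using integral_kernel_le[OF Gc that(3) Fc[OF that(1,2)] Fb[OF that(2)]] gn[OF that(3)]
    unfolding T_def R_def by linarith
  have Tcontr: "\<bar>T u t - T v t\<bar> \<le> q * c"
    if u: "continuous_on {0..a} u" "\<And>t. t \<in> {0..a} \<Longrightarrow> \<bar>u t\<bar> \<le> R"
      and v: "continuous_on {0..a} v" "\<And>t. t \<in> {0..a} \<Longrightarrow> \<bar>v t\<bar> \<le> R"
      and c: "\<And>t. t \<in> {0..a} \<Longrightarrow> \<bar>u t - v t\<bar> \<le> c" and t: "t \<in> {0..a}" for u v c t
  proof -
    have lip: "\<bar>F u s - F v s\<bar> \<le> (L1 + L2) * c" if s: "s \<in> {0..a}" for s
    proof -
      have "\<bar>F u s - F v s\<bar> \<le> L1 * \<bar>u s - v s\<bar> + L2 * \<bar>u (\<phi> s) - v (\<phi> s)\<bar>"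
        unfolding F_def using assms(14)[OF region[OF v(2) s] region[OF u(2) s]] .
      also have "\<dots> \<le> L1 * c + L2 * c"
        using c s \<phi> assms(12,13) by (intro add_mono mult_left_mono) auto
      finally show ?thesis by (simp add: algebra_simps)
    qed
    note Gt = continuous_on_slice[OF Gc t]
    have "T u t - T v t = integral {0..a} (\<lambda>s. G t s * F u s) - integral {0..a} (\<lambda>s. G t s * F v s)"
      unfolding T_def by simp
    also have "\<dots> = integral {0..a} (\<lambda>s. G t s * F u s - G t s * F v s)"
      by (rule integral_diff[symmetric])
         (intro integrable_continuous_interval continuous_on_mult Gt Fc u v; assumption)+
    also have "\<dots> = integral {0..a} (\<lambda>s. G t s * (F u s - F v s))"
      by (simp add: right_diff_distrib)
    also have "\<bar>\<dots>\<bar> \<le> green_bound a G * ((L1 + L2) * c)"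
      by (rule integral_kernel_le[OF Gc t continuous_on_diff[OF Fc[OF u] Fc[OF v]] lip])
    finally show ?thesis by (simp add: q_def algebra_simps)
  qed
  obtain x where x: "continuous_on {0..a} x" "\<And>t. t \<in> {0..a} \<Longrightarrow> \<bar>x t\<bar> \<le> R"
    "\<And>t. t \<in> {0..a} \<Longrightarrow> x t = T x t"
    using contraction_fixpoint_exists[of a R q T, OF a0(1) R q] bvp_solution_continuous_on[OF Tsol]
      Tb Tcontr by blast
  have Fx: "F x t = F (T x) t" if "t \<in> {0..a}" for t
    using x(3)[OF that] x(3)[OF \<phi>[OF that]] unfolding F_def by simp
  have sol: "bvp_solution a \<alpha> \<beta> \<gamma> b (F (T x)) (T x)"
    using Tsol[of x] x(1,2) bvp_solution_cong[of a "F x" "F (T x)"] Fx by blast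
  have uniq: "w t = T x t" if w: "bvp_solution a \<alpha> \<beta> \<gamma> b (F w) w"
    and wb: "\<And>t. t \<in> {0..a} \<Longrightarrow> \<bar>w t\<bar> \<le> R" and t: "t \<in> {0..a}" for w t
  proof -
    note wc = bvp_solution_continuous_on[OF w]
    have fix_w: "w s = T w s" if "s \<in> {0..a}" for s
      unfolding T_def by (rule green_function_unique[OF a G g Fc[OF wc wb] w that])
    have "w t = x t"
    proof (rule contraction_fixpoint_unique[OF a0(1) q(2) wc x(1) _ t])
      fix c s assume "\<And>t. t \<in> {0..a} \<Longrightarrow> \<bar>w t - x t\<bar> \<le> c" and s: "s \<in> {0..a}"
      from Tcontr[OF wc wb x(1,2) this] show "\<bar>w s - x s\<bar> \<le> q * c"
        using fix_w[OF s] x(3)[OF s] by simp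
    qed
    then show ?thesis using x(3)[OF t] by simp
  qed
  \<comment> \<open>\<open>x\<close> agrees with the solution \<open>T x\<close> only on \<open>[0,a]\<close>, so \<open>T x\<close> is the witness.\<close>
  show ?thesis
    using sol Tb[of x] x(1,2) uniq unfolding F_def R_def by (intro exI[of _ "T x"]) blast
qed

end
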